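(* Let $G$ be a graph of order $n$, and let $k$ be an integer with $\mathrm{Z}_+(G)\leq k\leq n$. Then $\mathrm{pt}_+(G,k)\leq\left\lceil\frac{n-k}{2}\right\rceil$.
   Context: Graphs are finite and simple. In PSD forcing each vertex is blue or white. PSD color change rule: let $B$ be the current set of blue vertices and let $W_1,\dots,W_r$ be the vertex sets of the components of $G-B$; if $u\in B$, $w\in W_i$, and $w$ is the only white neighbor of $u$ in $G[W_i\cup B]$, then $w$ may be colored blue ($u$ forces $w$). A set $B\subseteq V(G)$ is a PSD forcing set if starting with exactly $B$ blue, repeated application of the rule colors all of $V(G)$ blue; $\mathrm{Z}_+(G)$ is the minimum size of a PSD forcing set. Given an initial blue set $B$, set $B^{[0]}=B$ and, for $i\ge0$, let $B^{[i+1]}$ be $B^{[i]}$ together with all vertices that can be PSD forced by some vertex when exactly $B^{[i]}$ is blue. The PSD propagation time $\mathrm{pt}_+(G;B)$ is the least $t$ with $B^{[t]}=V(G)$ (infinity if no such $t$). For an integer $k$, $\mathrm{pt}_+(G,k)=\min_{|B|=k}\mathrm{pt}_+(G;B)$, and $\mathrm{pt}_+(G)=\mathrm{pt}_+(G,\mathrm{Z}_+(G))$. *)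

theory Defs
  imports Complex_Main "HOL-Library.Extended_Nat" "Graph_Theory.Digraph_Component"
begin

text \<open>
  A finite simple graph is a \<open>pre_digraph\<close> satisfying the locale predicate \<open>graph\<close>
  (finite, loop-free, no parallel arcs, symmetric). Because adjacency is symmetric, strongly
  connected components are the ordinary connected components, so the component vertex sets of
  \<open>G - B\<close> are \<open>pre_digraph.sccs_verts (G \<restriction> (verts G - B))\<close>.
\<close>

definition psd_forces :: "('a, 'b) pre_digraph \<Rightarrow> 'a set \<Rightarrow> 'a \<Rightarrow> 'a \<Rightarrow> bool" where
  "psd_forces G B u w \<longleftrightarrow> u \<in> B \<and>
     (\<exists>W \<in> pre_digraph.sccs_verts (G \<restriction> (verts G - B)).
        w \<in> W \<and> {v. v \<notin> B \<and> u \<rightarrow>\<^bsub>G \<restriction> (W \<union> B)\<^esub> v} = {w})"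

definition psd_color_change :: "('a, 'b) pre_digraph \<Rightarrow> 'a set \<Rightarrow> 'a set \<Rightarrow> bool" where
  "psd_color_change G B B' \<longleftrightarrow> (\<exists>u w. psd_forces G B u w \<and> B' = insert w B)"

definition psd_forcing_set :: "('a, 'b) pre_digraph \<Rightarrow> 'a set \<Rightarrow> bool" where
  "psd_forcing_set G B \<longleftrightarrow> B \<subseteq> verts G \<and> (psd_color_change G)\<^sup>*\<^sup>* B (verts G)"

definition psd_zero_forcing_number :: "('a, 'b) pre_digraph \<Rightarrow> nat" where
  "psd_zero_forcing_number G = Min {card B | B. psd_forcing_set G B}"

primrec psd_blue_at :: "('a, 'b) pre_digraph \<Rightarrow> 'a set \<Rightarrow> nat \<Rightarrow> 'a set" where
  "psd_blue_at G B 0 = B"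
| "psd_blue_at G B (Suc i) =
     psd_blue_at G B i \<union> {w. \<exists>u. psd_forces G (psd_blue_at G B i) u w}"

text \<open>The infimum of the empty set in \<^typ>\<open>enat\<close> is \<open>\<infinity>\<close>.\<close>

definition psd_pt_set :: "('a, 'b) pre_digraph \<Rightarrow> 'a set \<Rightarrow> enat" where
  "psd_pt_set G B = (INF t \<in> {t. psd_blue_at G B t = verts G}. enat t)"

definition psd_pt :: "('a, 'b) pre_digraph \<Rightarrow> nat \<Rightarrow> enat" where
  "psd_pt G k = (INF B \<in> {B. B \<subseteq> verts G \<and> card B = k}. psd_pt_set G B)"

end

theory Submission
  imports Defs
begin

text \<open>
  Among the sets of \<open>k\<close> vertices pick \<open>B\<close> with least propagation time \<open>t\<close>, and suppose
  \<open>t > \<lceil>(n - k) / 2\<rceil>\<close>. A vertex that turns blue last lies in a component \<open>W\<close> of \<open>G - B\<close>. Forcing in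
  \<open>W\<close> does not depend on the other components, so \<open>W\<close> gains a blue vertex at every step and
  \<open>|W| \<ge> t\<close>; hence the other components, with at most \<open>n - k - t\<close> vertices in total, are
  blue after \<open>n - k - t\<close> steps. Now replace in \<open>B\<close> each vertex that makes a force into \<open>W\<close> in the first
  step by the vertex it forces. Propagation in \<open>W\<close> gains one step, and since the new vertices
  force the removed ones back at once, the other components lose at most one step. The new set has
  propagation time at most \<open>t - 1\<close>, a contradiction.
\<close>

context graph
begin

section \<open>Connectivity among white vertices and the forcing rule\<close>

abbreviation white_reachable :: "'a set \<Rightarrow> 'a \<Rightarrow> 'a \<Rightarrow> bool" where
  "white_reachable S x y \<equiv> x \<rightarrow>\<^sup>*\<^bsub>G \<restriction> (verts G - S)\<^esub> y"

abbreviation psd_step :: "'a set \<Rightarrow> 'a set" where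
  "psd_step S \<equiv> S \<union> {w. \<exists>u. psd_forces G S u w}"

lemma dominates_induce_iff: "x \<rightarrow>\<^bsub>G \<restriction> S\<^esub> y \<longleftrightarrow> x \<rightarrow> y \<and> x \<in> S \<and> y \<in> S"
  by (auto simp: arcs_ends_def arc_to_ends_def)

lemma dominates_sym: "x \<rightarrow> y \<Longrightarrow> y \<rightarrow> x"
  using sym_arcs by (auto simp: symmetric_def dest: symD)

lemma wf_white: "wf_digraph (G \<restriction> (verts G - S))"
  by (rule wellformed_induce_subgraph)

lemma sym_white: "symmetric (G \<restriction> (verts G - S))"
  unfolding symmetric_def
  by (rule symI) (simp add: dominates_induce_iff dominates_sym)

lemma white_reachable_sym: "white_reachable S x y \<Longrightarrow> white_reachable S y x"
  by (rule symmetric_reachable[OF sym_white])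

lemma white_reachable_refl: "x \<in> verts G - S \<Longrightarrow> white_reachable S x x"
  by (simp add: reachable_def)

lemma white_reachableD:
  assumes "white_reachable S x y"
  shows "x \<in> verts G - S" "y \<in> verts G - S"
  using wf_digraph.reachable_in_verts[OF wf_white assms] by auto

lemma white_reachable_step:
  assumes "white_reachable S x y" "y \<rightarrow> z" "z \<notin> S"
  shows "white_reachable S x z"
proof (rule wf_digraph.reachable_adj_trans[OF wf_white assms(1)])
  show "y \<rightarrow>\<^bsub>G \<restriction> (verts G - S)\<^esub> z"
    using white_reachableD[OF assms(1)] assms adj_in_verts by (auto simp: dominates_induce_iff)
qed

lemma white_reachable_induct [consumes 1, case_names base step]:
  assumes "white_reachable S x y" and "P x"
    and "\<And>y z. white_reachable S x y \<Longrightarrow> P y \<Longrightarrow> y \<rightarrow> z \<Longrightarrow> y \<notin> S \<Longrightarrow> z \<notin> S \<Longrightarrow> P z"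
  shows "P y"
  using assms(1)
proof (induction rule: wf_digraph.reachable_induct[OF wf_white, consumes 1, case_names base step])
  case base
  then show ?case using assms(2) by simp
next
  case (step y z)
  then show ?case using assms(3)[of y z] by (auto simp: dominates_induce_iff)
qed

text \<open>The component of \<open>w\<close> is the set of vertices white-reachable from
  \<open>w\<close>, so the quantifier over components in the definition can be eliminated.\<close>

lemma psd_forces_iff:
  "psd_forces G S u w \<longleftrightarrow> u \<in> S \<and> w \<notin> S \<and> u \<rightarrow> w \<and>
     (\<forall>v. white_reachable S w v \<longrightarrow> u \<rightarrow> v \<longrightarrow> v = w)"
proof
  assume "psd_forces G S u w"
  then obtain W where W: "u \<in> S" "W \<in> pre_digraph.sccs_verts (G \<restriction> (verts G - S))" "w \<in> W"
    "{v. v \<notin> S \<and> u \<rightarrow>\<^bsub>G \<restriction> (W \<union> S)\<^esub> v} = {w}"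
    unfolding psd_forces_def by blast
  have "v \<in> W" if "white_reachable S w v" for v
    using W(2,3) that white_reachable_sym[OF that]
    unfolding pre_digraph.sccs_verts_def by blast
  then show "u \<in> S \<and> w \<notin> S \<and> u \<rightarrow> w \<and> (\<forall>v. white_reachable S w v \<longrightarrow> u \<rightarrow> v \<longrightarrow> v = w)"
    using W white_reachableD by (auto simp: dominates_induce_iff set_eq_iff)
next
  assume *: "u \<in> S \<and> w \<notin> S \<and> u \<rightarrow> w \<and> (\<forall>v. white_reachable S w v \<longrightarrow> u \<rightarrow> v \<longrightarrow> v = w)"
  let ?W = "{v. white_reachable S w v}"
  have w: "white_reachable S w w"
    using * adj_in_verts by (intro white_reachable_refl) auto
  have "?W = pre_digraph.scc_of (G \<restriction> (verts G - S)) w"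
    unfolding pre_digraph.scc_of_def using white_reachable_sym by blast
  then have "?W \<in> pre_digraph.sccs_verts (G \<restriction> (verts G - S))"
    using wf_digraph.scc_of_in_sccs_verts[OF wf_white, of w S] white_reachableD[OF w] by simp
  moreover have "{v. v \<notin> S \<and> u \<rightarrow>\<^bsub>G \<restriction> (?W \<union> S)\<^esub> v} = {w}"
    using * w by (auto simp: dominates_induce_iff)
  ultimately show "psd_forces G S u w"
    unfolding psd_forces_def using * w by blast
qed

lemma psd_forces_in_verts: "psd_forces G S u w \<Longrightarrow> w \<in> verts G"
  using adj_in_verts by (auto simp: psd_forces_iff)

text \<open>Forcing inside \<open>Y\<close> only depends on the colors in \<open>Y\<close> once the boundary of \<open>Y\<close> is blue.\<close>

lemma psd_step_local_mono:
  assumes bdS: "\<And>x y. y \<in> Y \<Longrightarrow> x \<rightarrow> y \<Longrightarrow> x \<notin> Y \<Longrightarrow> x \<in> S'"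
    and sub: "S \<inter> Y \<subseteq> S'"
  shows "psd_step S \<inter> Y \<subseteq> psd_step S'"
proof
  fix w assume w: "w \<in> psd_step S \<inter> Y"
  show "w \<in> psd_step S'"
  proof (cases "w \<in> S'")
    case False
    with w sub obtain u where u: "psd_forces G S u w" by blast
    \<comment> \<open>A walk from \<open>w\<close> avoiding \<open>S'\<close> cannot leave
      \<open>Y\<close>, whose outer neighbors lie in \<open>S'\<close>, and inside \<open>Y\<close>
      it avoids \<open>S\<close> too. So the component of \<open>w\<close> for \<open>S'\<close>
      lies within its component for \<open>S\<close>, and \<open>u\<close> still forces
      \<open>w\<close>.\<close>
    have "v \<in> Y \<and> white_reachable S w v" if "white_reachable S' w v" for v
      using that
    proof (induction rule: white_reachable_induct)
      case base
      then show ?case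
        using w u psd_forces_in_verts by (auto simp: psd_forces_iff intro: white_reachable_refl)
    next
      case (step y z)
      then have "z \<in> Y" using bdS dominates_sym by blast
      then show ?case using step sub white_reachable_step by blast
    qed
    then have "psd_forces G S' u w"
      using u w False sub bdS unfolding psd_forces_iff by blast
    then show ?thesis by blast
  qed simp
qed

section \<open>Monotonicity and speed of propagation\<close>

lemma psd_step_mono: "S \<subseteq> S' \<Longrightarrow> psd_step S \<subseteq> psd_step S'"
  using psd_step_local_mono[of UNIV S' S] by auto

lemma psd_blue_at_mono: "S \<subseteq> S' \<Longrightarrow> psd_blue_at G S i \<subseteq> psd_blue_at G S' i"
proof (induction i)
  case (Suc i)
  then show ?case using psd_step_mono by simp
qed simp

lemma psd_blue_at_time_mono: "i \<le> j \<Longrightarrow> psd_blue_at G S i \<subseteq> psd_blue_at G S j"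
  by (rule lift_Suc_mono_le) auto

lemma psd_blue_at_Suc_shift: "psd_blue_at G S (Suc i) = psd_blue_at G (psd_step S) i"
  by (induction i) simp_all

lemma psd_blue_at_subset_verts: "S \<subseteq> verts G \<Longrightarrow> psd_blue_at G S i \<subseteq> verts G"
  by (induction i) (auto dest: psd_forces_in_verts)

text \<open>By monotonicity a simultaneous step absorbs any single force, so forcing sets have
  finite propagation time.\<close>

lemma psd_color_change_blue_at:
  assumes "(psd_color_change G)\<^sup>*\<^sup>* S T"
  shows "\<exists>t. T \<subseteq> psd_blue_at G S t"
  using assms
proof (induction rule: rtranclp_induct)
  case base
  then show ?case by (intro exI[of _ 0]) simp
next
  case (step T T')
  then obtain t where t: "T \<subseteq> psd_blue_at G S t" by blast
  have "T' \<subseteq> psd_step T" using step(2) by (auto simp: psd_color_change_def)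
  also have "\<dots> \<subseteq> psd_blue_at G S (Suc t)" using psd_step_mono[OF t] by simp
  finally show ?case by blast
qed

text \<open>By locality, once a step adds nothing in \<open>Y\<close>, no later step does. As
  \<open>Y\<close> does become blue, every step before that gains at least one vertex of it.\<close>

lemma psd_blue_at_card:
  assumes bd: "\<And>x y. y \<in> Y \<Longrightarrow> x \<rightarrow> y \<Longrightarrow> x \<notin> Y \<Longrightarrow> x \<in> B"
    and fin: "finite Y" and full: "Y \<subseteq> psd_blue_at G B t"
  shows "Y \<subseteq> psd_blue_at G B (card Y)"
proof -
  let ?b = "psd_blue_at G B"
  have stuck: "?b j \<inter> Y \<subseteq> ?b i" if "?b (Suc i) \<inter> Y \<subseteq> ?b i" for i j
  proof (induction j)
    case 0
    then show ?case using psd_blue_at_time_mono[of 0 i B] by auto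
  next
    case (Suc j)
    have "psd_step (?b j) \<inter> Y \<subseteq> psd_step (?b i)"
      using bd psd_blue_at_time_mono[of 0 i B] Suc by (intro psd_step_local_mono) auto
    then show ?case using that by auto
  qed
  have "Y \<subseteq> ?b i \<or> i \<le> card (Y \<inter> ?b i)" for i
  proof (induction i)
    case (Suc i)
    show ?case
    proof (cases "Y \<subseteq> ?b i")
      case True
      then show ?thesis by auto
    next
      case False
      then have "\<not> ?b (Suc i) \<inter> Y \<subseteq> ?b i" using stuck[of i t] full by blast
      then have "Y \<inter> ?b i \<subset> Y \<inter> ?b (Suc i)" by auto
      then have "card (Y \<inter> ?b i) < card (Y \<inter> ?b (Suc i))"
        using fin by (intro psubset_card_mono) auto
      then show ?thesis using Suc False by linarith
    qed
  qed simp
  from this[of "card Y"] show ?thesis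
    using fin card_seteq[of Y "Y \<inter> ?b (card Y)"] by blast
qed

section \<open>The exchange argument\<close>

text \<open>The hypothesis \<open>late\<close> is t > \<lceil>(n - k) / 2\<rceil> in integer form,
  with k = \<open>card B\<close>.\<close>

lemma psd_speedup:
  assumes BV: "B \<subseteq> verts G" and full: "psd_blue_at G B t = verts G"
    and notyet: "psd_blue_at G B (t - 1) \<noteq> verts G"
    and late: "card (verts G) - card B + 2 \<le> 2 * t"
  shows "\<exists>B'. B' \<subseteq> verts G \<and> card B' = card B \<and> psd_blue_at G B' (t - 1) = verts G"
proof -
  let ?b = "psd_blue_at G"
  have finB: "finite B" using finite_subset[OF BV finite_verts] .
  obtain x where x: "x \<in> verts G" "x \<notin> ?b B (t - 1)"
    using notyet psd_blue_at_subset_verts[OF BV] by blast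
  then have xB: "x \<notin> B" using psd_blue_at_time_mono[of 0 "t - 1" B] by auto
  define W where "W = {v. white_reachable B x v}"
  define U where "U = verts G - B - W"
  have xW: "x \<in> W" using x xB by (simp add: W_def white_reachable_refl)
  have WV: "W \<subseteq> verts G" and WB: "W \<inter> B = {}"
    using white_reachableD by (auto simp: W_def)
  have conn: "white_reachable B v w" if "v \<in> W" "w \<in> W" for v w
    using that wf_digraph.reachable_trans[OF wf_white] white_reachable_sym
    unfolding W_def by blast
  have bdW: "y \<in> B" if "w \<in> W" "y \<rightarrow> w" "y \<notin> W" for w y
    using that dominates_sym white_reachable_step unfolding W_def by blast
  have bdU: "y \<in> B" if "w \<in> U" "y \<rightarrow> w" "y \<notin> U" for w y
    using that bdW[of y w] dominates_sym adj_in_verts unfolding U_def by blast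
  have finW: "finite W" and finU: "finite U"
    using finite_subset[OF WV finite_verts] unfolding U_def by auto
  have UV: "U \<subseteq> verts G" by (auto simp: U_def)
  have cardWU: "card W + card U = card (verts G) - card B"
  proof -
    have "card (W \<union> U) = card W + card U"
      using finW finU by (intro card_Un_disjoint) (auto simp: U_def)
    moreover have "W \<union> U = verts G - B" using WV WB by (auto simp: U_def)
    ultimately show ?thesis using card_Diff_subset[OF finB BV] by simp
  qed
  have "W \<subseteq> ?b B (card W)"
    by (rule psd_blue_at_card[where t = t]) (simp_all add: bdW finW full WV)
  \<comment> \<open>\<open>W\<close> is entirely blue after \<open>card W\<close> steps, but its
    vertex \<open>x\<close> is still white after \<open>t - 1\<close>.\<close>
  then have tW: "t \<le> card W"
    using x xW psd_blue_at_time_mono[of "card W" "t - 1" B] by fastforce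
  have Ublue: "U \<subseteq> ?b B (card U)"
    by (rule psd_blue_at_card[where t = t]) (simp_all add: bdU finU full UV)

  define F where "F = psd_step B \<inter> W"
  have "\<forall>w\<in>F. \<exists>u. psd_forces G B u w" using WB by (auto simp: F_def)
  then obtain g where g: "\<And>w. w \<in> F \<Longrightarrow> psd_forces G B (g w) w" by metis
  have gB: "g w \<in> B" and g_adj: "g w \<rightarrow> w" if "w \<in> F" for w
    using g[OF that] by (auto simp: psd_forces_iff)
  \<comment> \<open>\<open>W\<close> is a single white component, so a chosen forcer has no second
    neighbor in it. This makes \<open>g\<close> injective and keeps removed vertices away from
    \<open>W - F\<close>.\<close>
  have g_uniq: "v = w" if "w \<in> F" "v \<in> W" "g w \<rightarrow> v" for v w
    using g[OF that(1)] conn[of w v] that by (auto simp: psd_forces_iff F_def)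
  have FW: "F \<subseteq> W" by (simp add: F_def)
  have inj: "inj_on g F"
    using g_uniq g_adj FW by (intro inj_onI) (metis subsetD)
  define B' where "B' = (B - g ` F) \<union> F"
  have B'V: "B' \<subseteq> verts G" using BV FW WV by (auto simp: B'_def)
  have cardB': "card B' = card B"
  proof -
    have gF: "g ` F \<subseteq> B" using gB by blast
    have finF: "finite F" using finW FW finite_subset by blast
    have "card B' = card (B - g ` F) + card F"
      unfolding B'_def using finB finF FW WB by (intro card_Un_disjoint) auto
    also have "\<dots> = card B - card F + card F"
      using card_Diff_subset[OF finite_subset[OF gF finB] gF] card_image[OF inj] by simp
    also have "\<dots> = card B"
      using card_mono[OF finB gF] card_image[OF inj] by simp
    finally show ?thesis .
  qed

  have forces_back: "psd_forces G B' w (g w)" if w: "w \<in> F" for w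
  proof -
    \<comment> \<open>An edge entering \<open>W\<close> from a white vertex outside would start at
      some removed \<open>g w'\<close>; its only neighbor in \<open>W\<close> is \<open>w'\<close>,
      which is blue in \<open>B'\<close>.\<close>
    have outside: "v \<notin> W" if "white_reachable B' (g w) v" for v
      using that
    proof (induction rule: white_reachable_induct)
      case base
      then show ?case using gB w WB by auto
    next
      case (step y z)
      show ?case
      proof
        assume "z \<in> W"
        then obtain w' where "w' \<in> F" "y = g w'"
          using bdW[of z y] step by (auto simp: B'_def)
        then show False using g_uniq[of w' z] step \<open>z \<in> W\<close> by (auto simp: B'_def)
      qed
    qed
    have "v = g w" if v: "white_reachable B' (g w) v" "w \<rightarrow> v" for v
    proof -
      \<comment> \<open>Outside \<open>W\<close>, neighbors of \<open>w\<close> lie in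
        \<open>B\<close>. A white one is thus some \<open>g w'\<close>, and uniqueness gives
        \<open>w' = w\<close>.\<close>
      have "v \<in> B" using bdW[of w v] outside v dominates_sym w FW by blast
      then obtain w' where "w' \<in> F" "v = g w'"
        using white_reachableD(2)[OF v(1)] by (auto simp: B'_def)
      then show ?thesis using g_uniq[of w' w] v dominates_sym w FW by blast
    qed
    moreover have "g w \<notin> B'" using gB w FW WB by (auto simp: B'_def)
    moreover have "w \<in> B'" using w by (simp add: B'_def)
    ultimately show ?thesis using g_adj[OF w] dominates_sym by (simp add: psd_forces_iff)
  qed
  then have Bstep: "B \<subseteq> psd_step B'" by (auto simp: B'_def)

  have delayed: "?b B i \<subseteq> ?b B' (Suc i)" for i
    using psd_blue_at_mono[OF Bstep] by (simp only: psd_blue_at_Suc_shift)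
  \<comment> \<open>Neighbors of \<open>W - F\<close> lie in \<open>F\<close> inside
    \<open>W\<close>, and outside it in \<open>B\<close> but not among the removed forcers, so
    locality applies to \<open>W - F\<close> with \<open>B'\<close>.\<close>
  have bdWF: "y \<in> B'" if "w \<in> W - F" "y \<rightarrow> w" "y \<notin> W - F" for w y
  proof (cases "y \<in> W")
    case False
    then have "y \<in> B" using bdW that by blast
    moreover have "y \<notin> g ` F" using g_uniq that by blast
    ultimately show ?thesis by (simp add: B'_def)
  qed (use that in \<open>simp add: B'_def\<close>)
  have ahead: "?b B (Suc i) \<inter> (W - F) \<subseteq> ?b B' i" for i
  proof (induction i)
    case 0
    then show ?case by (auto simp: F_def)
  next
    case (Suc i)
    have "psd_step (?b B (Suc i)) \<inter> (W - F) \<subseteq> psd_step (?b B' i)"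
      using bdWF psd_blue_at_time_mono[of 0 i B'] Suc
      by (intro psd_step_local_mono) auto
    then show ?case by simp
  qed

  \<comment> \<open>\<open>W\<close> is nonempty, so \<open>late\<close> gives
    \<open>2 * t \<ge> 3\<close>. Hence \<open>t - 1 \<ge> 1\<close>, leaving time to force the
    removed vertices back.\<close>
  have t2: "t \<ge> 2" using tW cardWU late xW finW card_gt_0_iff[of W] by auto
  have "B \<subseteq> ?b B' (t - 1)"
  proof -
    have "?b B' (Suc 0) \<subseteq> ?b B' (t - 1)" using t2 by (intro psd_blue_at_time_mono) simp
    then show ?thesis using delayed[of 0] by auto
  qed
  moreover have "W \<subseteq> ?b B' (t - 1)"
  proof -
    have "F \<subseteq> ?b B' (t - 1)" using psd_blue_at_time_mono[of 0 "t - 1" B'] by (auto simp: B'_def)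
    moreover have "W - F \<subseteq> ?b B' (t - 1)" using ahead[of "t - 1"] full WV t2 by auto
    ultimately show ?thesis by blast
  qed
  moreover have "U \<subseteq> ?b B' (t - 1)"
  proof -
    \<comment> \<open>From \<open>t + card U \<le> n - k \<le> 2 * t - 2\<close> follows
      \<open>card U \<le> t - 2\<close>; the spare step pays for the delay.\<close>
    have "Suc (card U) \<le> t - 1" using tW cardWU late by linarith
    then show ?thesis
      using Ublue delayed[of "card U"] psd_blue_at_time_mono[of "Suc (card U)" "t - 1" B'] by blast
  qed
  ultimately have "verts G \<subseteq> ?b B' (t - 1)" by (auto simp: U_def)
  then show ?thesis using B'V cardB' psd_blue_at_subset_verts[OF B'V] by blast
qed

text \<open>A minimum forcing set is enlarged to \<open>k\<close> vertices; extra blue vertices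
  never slow propagation.\<close>

lemma psd_forcing_set_of_card:
  assumes "psd_zero_forcing_number G \<le> k" "k \<le> card (verts G)"
  shows "\<exists>B t. B \<subseteq> verts G \<and> card B = k \<and> psd_blue_at G B t = verts G"
proof -
  let ?C = "{card B | B. psd_forcing_set G B}"
  have "?C \<subseteq> card ` Pow (verts G)" by (auto simp: psd_forcing_set_def)
  then have "finite ?C" by (rule finite_subset) simp
  moreover have "psd_forcing_set G (verts G)" by (simp add: psd_forcing_set_def)
  ultimately have "Min ?C \<in> ?C" by (intro Min_in) auto
  then obtain A where A: "psd_forcing_set G A" "card A \<le> k"
    using assms(1) unfolding psd_zero_forcing_number_def by auto
  then have AV: "A \<subseteq> verts G" by (simp add: psd_forcing_set_def)
  obtain B where B: "A \<subseteq> B" "B \<subseteq> verts G" "card B = k"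
    using exists_subset_between[OF A(2) assms(2) AV] by auto
  obtain t where "verts G \<subseteq> psd_blue_at G A t"
    using A(1) psd_color_change_blue_at[of A "verts G"] by (auto simp: psd_forcing_set_def)
  then have "psd_blue_at G B t = verts G"
    using psd_blue_at_mono[OF B(1), of t] psd_blue_at_subset_verts[OF B(2), of t] by blast
  then show ?thesis using B by blast
qed

end

theorem theorem2p5:
  fixes G :: "('a, 'b) pre_digraph" and n k :: nat
  assumes "graph G" and "card (verts G) = n"
    and "psd_zero_forcing_number G \<le> k" and "k \<le> n"
  shows "psd_pt G k \<le> enat (nat \<lceil>(real n - real k) / 2\<rceil>)"
proof -
  interpret graph G by (rule assms(1))
  define P where
    "P t \<longleftrightarrow> (\<exists>B. B \<subseteq> verts G \<and> card B = k \<and> psd_blue_at G B t = verts G)" for t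
  define t where "t = (LEAST t. P t)"
  have "\<exists>t. P t" using psd_forcing_set_of_card assms unfolding P_def by blast
  then have Pt: "P t" unfolding t_def by (rule LeastI_ex)
  have least: "\<not> P s" if "s < t" for s using that not_less_Least unfolding t_def by blast
  obtain B where B: "B \<subseteq> verts G" "card B = k" "psd_blue_at G B t = verts G"
    using Pt unfolding P_def by blast
  have "\<not> n - k + 2 \<le> 2 * t"
  proof
    assume late: "n - k + 2 \<le> 2 * t"
    \<comment> \<open>\<open>late\<close> forces \<open>t \<ge> 1\<close>, so the truncated
      \<open>t - 1\<close> really is below the minimum \<open>t\<close>.\<close>
    then have "\<not> P (t - 1)" by (intro least) simp
    then show False
      using psd_speedup[of B t] B late assms(2) unfolding P_def by auto
  qed
  then have "real t < (real n - real k) / 2 + 1" using assms(4) by (simp add: field_simps of_nat_diff)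
  then have le: "t \<le> nat \<lceil>(real n - real k) / 2\<rceil>" by linarith
  have "psd_pt G k \<le> psd_pt_set G B"
    unfolding psd_pt_def using B by (intro INF_lower) simp
  also have "\<dots> \<le> enat t"
    unfolding psd_pt_set_def using B by (intro INF_lower) simp
  also have "\<dots> \<le> enat (nat \<lceil>(real n - real k) / 2\<rceil>)" using le by simp
  finally show ?thesis .
qed

end
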